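(* Let $G$ be a connected plane bipartite graph with a perfect matching. Suppose that for every nice cycle $C$ of $G$ and every maximum resonant set $K$ of $I[C]$, the graph $I[C]-K$ has a unique perfect matching. Then $G$ is weakly elementary.
   Context: For a perfect matching $M$, a cycle is $M$-alternating if its edges alternate between edges in $M$ and not in $M$; a finite face is $M$-resonant if its boundary is $M$-alternating. A resonant set of a plane graph is a set of pairwise vertex-disjoint finite faces all $M$-resonant for a common perfect matching $M$; a maximum resonant set is one of largest size. A cycle $C$ of $G$ is nice if $G$ has a perfect matching $M$ for which $C$ is $M$-alternating. $I[C]$ is the subgraph of $G$ consisting of $C$ together with its interior; $I[C]-K$ is obtained by deleting all vertices on boundaries of faces in $K$ (the empty graph has exactly one perfect matching). An edge of $G$ is allowed if it lies in some perfect matching of $G$. $G$ is weakly elementary if for every nice cycle $C$ of $G$ whose interior contains an edge of $G$, the interior of $C$ contains at least one allowed edge of $G$ incident with a vertex of $C$. *)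

theory Defs
  imports "HOL-Analysis.Analysis"
begin

text \<open>Plane graphs are finite simple graphs drawn in the complex plane: vertices are points and
  edges are arcs, each represented by its point set (which includes both end points).\<close>

record geom_graph =
  verts :: "complex set"
  edges :: "complex set set"

text \<open>In a plane graph \<open>G\<close>, the end points of an edge \<open>e\<close> are exactly the elements of
  \<open>e \<inter> verts G\<close>. Since \<open>arc g\<close> makes \<open>g\<close> injective, there are no loops; the last
  condition excludes crossings and parallel edges.\<close>

definition plane_graph :: "geom_graph \<Rightarrow> bool" where
  "plane_graph G \<longleftrightarrow>
     finite (verts G) \<and> finite (edges G) \<and>
     (\<forall>e\<in>edges G. \<exists>g. arc g \<and> path_image g = e \<and>
        e \<inter> verts G = {pathstart g, pathfinish g}) \<and>
     (\<forall>e\<in>edges G. \<forall>f\<in>edges G. e \<noteq> f \<longrightarrow>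
        e \<inter> f \<subseteq> verts G \<and> e \<inter> verts G \<noteq> f \<inter> verts G)"

definition support :: "geom_graph \<Rightarrow> complex set" where
  "support G = verts G \<union> \<Union>(edges G)"

definition subgraph :: "geom_graph \<Rightarrow> geom_graph \<Rightarrow> bool" where
  "subgraph H G \<longleftrightarrow> verts H \<subseteq> verts G \<and> edges H \<subseteq> edges G \<and>
     (\<forall>e\<in>edges H. e \<inter> verts G \<subseteq> verts H)"

definition adjacency :: "geom_graph \<Rightarrow> (complex \<times> complex) set" where
  "adjacency G = {(u, v). \<exists>e\<in>edges G. e \<inter> verts G = {u, v}}"

definition connected_graph :: "geom_graph \<Rightarrow> bool" where
  "connected_graph G \<longleftrightarrow> verts G \<noteq> {} \<and>
     (\<forall>u\<in>verts G. \<forall>v\<in>verts G. (u, v) \<in> (adjacency G)\<^sup>*)"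

definition bipartite :: "geom_graph \<Rightarrow> bool" where
  "bipartite G \<longleftrightarrow> (\<exists>A B. A \<union> B = verts G \<and> A \<inter> B = {} \<and>
     (\<forall>e\<in>edges G. \<exists>a\<in>A. \<exists>b\<in>B. e \<inter> verts G = {a, b}))"

definition perfect_matching :: "geom_graph \<Rightarrow> complex set set \<Rightarrow> bool" where
  "perfect_matching G M \<longleftrightarrow> M \<subseteq> edges G \<and> (\<forall>v\<in>verts G. \<exists>!e. e \<in> M \<and> v \<in> e)"

definition allowed_edge :: "geom_graph \<Rightarrow> complex set \<Rightarrow> bool" where
  "allowed_edge G e \<longleftrightarrow> (\<exists>M. perfect_matching G M \<and> e \<in> M)"

definition cycle_of :: "geom_graph \<Rightarrow> geom_graph \<Rightarrow> bool" where
  "cycle_of G C \<longleftrightarrow> subgraph C G \<and>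
     (\<exists>n v. 3 \<le> n \<and> inj_on v {..<n} \<and> verts C = v ` {..<n} \<and>
        (\<lambda>e. e \<inter> verts C) ` edges C = (\<lambda>i. {v i, v (Suc i mod n)}) ` {..<n})"

text \<open>Distinct edges of a cycle of a plane graph are consecutive iff they intersect.\<close>

definition alternating :: "complex set set \<Rightarrow> geom_graph \<Rightarrow> bool" where
  "alternating M C \<longleftrightarrow>
     (\<forall>e\<in>edges C. \<forall>f\<in>edges C. e \<noteq> f \<and> e \<inter> f \<noteq> {} \<longrightarrow> (e \<in> M \<longleftrightarrow> f \<notin> M))"

definition nice_cycle :: "geom_graph \<Rightarrow> geom_graph \<Rightarrow> bool" where
  "nice_cycle G C \<longleftrightarrow> cycle_of G C \<and> (\<exists>M. perfect_matching G M \<and> alternating M C)"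

definition finite_faces :: "geom_graph \<Rightarrow> complex set set" where
  "finite_faces G = {f \<in> components (- support G). bounded f}"

definition resonant_face :: "geom_graph \<Rightarrow> complex set set \<Rightarrow> complex set \<Rightarrow> bool" where
  "resonant_face G M f \<longleftrightarrow> f \<in> finite_faces G \<and>
     (\<exists>C. cycle_of G C \<and> frontier f = support C \<and> alternating M C)"

text \<open>A plane graph has only finitely many faces, so \<open>finite K\<close> is no restriction.\<close>

definition resonant_set :: "geom_graph \<Rightarrow> complex set set \<Rightarrow> bool" where
  "resonant_set G K \<longleftrightarrow> finite K \<and> K \<subseteq> finite_faces G \<and>
     pairwise (\<lambda>f g. frontier f \<inter> frontier g \<inter> verts G = {}) K \<and>
     (\<exists>M. perfect_matching G M \<and> (\<forall>f\<in>K. resonant_face G M f))"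

definition maximum_resonant_set :: "geom_graph \<Rightarrow> complex set set \<Rightarrow> bool" where
  "maximum_resonant_set G K \<longleftrightarrow> resonant_set G K \<and>
     (\<forall>K'. resonant_set G K' \<longrightarrow> card K' \<le> card K)"

text \<open>\<open>I[C]\<close> as a subgraph of \<open>G\<close>\<close>

definition inner_graph :: "geom_graph \<Rightarrow> geom_graph \<Rightarrow> geom_graph" where
  "inner_graph G C =
     \<lparr>verts = {v \<in> verts G. v \<in> support C \<union> inside (support C)},
      edges = {e \<in> edges G. e \<subseteq> support C \<union> inside (support C)}\<rparr>"

definition delete_faces :: "geom_graph \<Rightarrow> complex set set \<Rightarrow> geom_graph" where
  "delete_faces G K = (let S = verts G \<inter> (\<Union>f\<in>K. frontier f) in
     \<lparr>verts = verts G - S, edges = {e \<in> edges G. e \<inter> S = {}}\<rparr>)"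

text \<open>An edge lies in the interior of \<open>C\<close> if it does so without its end points, which may
  belong to \<open>C\<close>.\<close>

definition interior_edge :: "geom_graph \<Rightarrow> geom_graph \<Rightarrow> complex set \<Rightarrow> bool" where
  "interior_edge G C e \<longleftrightarrow> e \<in> edges G \<and> e - verts G \<subseteq> inside (support C)"

definition weakly_elementary :: "geom_graph \<Rightarrow> bool" where
  "weakly_elementary G \<longleftrightarrow>
     (\<forall>C. nice_cycle G C \<and> (\<exists>e. interior_edge G C e) \<longrightarrow>
        (\<exists>e. interior_edge G C e \<and> allowed_edge G e \<and> e \<inter> verts C \<noteq> {}))"

end

theory Submission
  imports Defs
begin

text \<open>Let \<open>C\<close> be a nice cycle with an edge in its interior, and suppose that no allowed edge in the
  interior of \<open>C\<close> meets \<open>C\<close>. Perfect matchings of \<open>H = I[C]\<close> extend to \<open>G\<close>, so every edge of an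
  alternating cycle \<open>D\<close> of \<open>H\<close> is allowed in \<open>G\<close>. If \<open>D\<close> meets \<open>C\<close>, it can therefore never leave
  \<open>C\<close>; a face bounded by \<open>D\<close> would then be the whole interior of \<open>C\<close> by the Jordan curve theorem,
  although an edge runs through it. Hence a maximum resonant set \<open>K\<close> of \<open>H\<close> avoids \<open>C\<close>, and a
  perfect matching realising \<open>K\<close> restricts to one of \<open>H - K\<close> for which \<open>C\<close> is alternating.
  Switching along \<open>C\<close> gives a second one.\<close>

section \<open>Plane graphs and subgraphs\<close>

lemma plane_graph_arcE:
  assumes "plane_graph G" "e \<in> edges G"
  obtains g where "arc g" "path_image g = e" "e \<inter> verts G = {pathstart g, pathfinish g}"
proof -
  have "\<forall>e\<in>edges G. \<exists>g. arc g \<and> path_image g = e \<and> e \<inter> verts G = {pathstart g, pathfinish g}"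
    using assms(1) by (simp add: plane_graph_def)
  then show thesis using assms(2) that by blast
qed

lemma plane_graph_Int_edges:
  assumes "plane_graph G" "e \<in> edges G" "f \<in> edges G" "e \<noteq> f"
  shows "e \<inter> f \<subseteq> verts G"
  using assms by (simp add: plane_graph_def)

lemma plane_graph_inj_ends:
  assumes "plane_graph G" "e \<in> edges G" "f \<in> edges G" "e \<inter> verts G = f \<inter> verts G"
  shows "e = f"
proof (rule ccontr)
  assume "e \<noteq> f"
  then show False using assms by (simp add: plane_graph_def)
qed

lemma finite_verts: "plane_graph G \<Longrightarrow> finite (verts G)"
  by (simp add: plane_graph_def)

lemma subgraph_edge_verts:
  assumes "subgraph H G" "e \<in> edges H"
  shows "e \<inter> verts H = e \<inter> verts G"
  using assms unfolding subgraph_def by blast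

lemma plane_graph_subgraph:
  assumes "plane_graph G" "subgraph H G"
  shows "plane_graph H"
proof -
  have sub: "verts H \<subseteq> verts G" "edges H \<subseteq> edges G"
    using assms(2) by (auto simp: subgraph_def)
  have ends: "e \<inter> verts H = e \<inter> verts G" if "e \<in> edges H" for e
    using subgraph_edge_verts[OF assms(2) that] .
  have "e \<inter> f \<subseteq> verts H \<and> e \<inter> verts H \<noteq> f \<inter> verts H"
    if "e \<in> edges H" "f \<in> edges H" "e \<noteq> f" for e f
    using that sub ends[of e] ends[of f] plane_graph_Int_edges[OF assms(1), of e f]
      plane_graph_inj_ends[OF assms(1), of e f] by blast
  moreover have "\<exists>g. arc g \<and> path_image g = e \<and> e \<inter> verts H = {pathstart g, pathfinish g}"
    if "e \<in> edges H" for e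
  proof -
    have "e \<in> edges G" using that sub by blast
    then show ?thesis using ends[OF that] assms(1) by (simp add: plane_graph_def)
  qed
  ultimately show ?thesis
    using assms(1) sub unfolding plane_graph_def by (meson finite_subset)
qed

section \<open>Point-set topology of a single edge\<close>

lemma infinite_edge:
  assumes "plane_graph G" "e \<in> edges G"
  shows "infinite e"
proof -
  obtain g where g: "arc g" "path_image g = e" by (rule plane_graph_arcE[OF assms]) blast
  have "inj_on g {0..1}" using g(1) by (simp add: arc_def)
  moreover have "infinite {0..1::real}" by simp
  ultimately show ?thesis using g(2) finite_imageD unfolding path_image_def by blast
qed

lemma closed_edge:
  assumes "plane_graph G" "e \<in> edges G"
  shows "closed e"
proof -
  obtain g where "arc g" "path_image g = e" by (rule plane_graph_arcE[OF assms]) blast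
  then show ?thesis using closed_path_image arc_imp_path by blast
qed

lemma connected_edge:
  assumes "plane_graph G" "e \<in> edges G"
  shows "connected e"
proof -
  obtain g where "arc g" "path_image g = e" by (rule plane_graph_arcE[OF assms]) blast
  then show ?thesis using connected_path_image arc_imp_path by blast
qed

text \<open>Only the two ends of the arc are vertices, so by injectivity what remains is the
  continuous image of the open unit interval. This form is needed because edges may touch a cycle at
  their ends.\<close>

lemma connected_edge_minus_verts:
  assumes "plane_graph G" "e \<in> edges G"
  shows "connected (e - verts G)"
proof -
  obtain g where g: "arc g" "path_image g = e" "e \<inter> verts G = {pathstart g, pathfinish g}"
    by (rule plane_graph_arcE[OF assms]) blast
  have inj: "inj_on g {0..1}" and cont: "continuous_on {0..1} g"
    using g(1) by (auto simp: arc_def path_def)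
  have "{0..1} - {0,1} = {0<..<1::real}" by auto
  moreover have "g ` ({0..1} - {0,1}) = g ` {0..1} - g ` {0,1}"
    by (rule inj_on_image_set_diff[OF inj]) auto
  ultimately have "e - verts G = g ` {0<..<1}"
    using g(2,3) by (auto simp: path_image_def pathstart_def pathfinish_def)
  moreover have "connected (g ` {0<..<1})"
    by (intro connected_continuous_image continuous_on_subset[OF cont]) auto
  ultimately show ?thesis by simp
qed

section \<open>Cycles\<close>

text \<open>\<open>cycle_of\<close> describes edges only through their pairs of ends. Without
  parallel edges a pair determines its edge, so the edges can be indexed along with the vertices,
  \<open>E i\<close> leading from \<open>v i\<close> to its cyclic successor.\<close>

lemma cycle_enum:
  assumes "plane_graph G" "cycle_of G C"
  obtains n v E where "3 \<le> n" "inj_on v {..<n}" "verts C = v ` {..<n}" "edges C = E ` {..<n}"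
    "inj_on E {..<n}" "\<forall>i<n. E i \<inter> verts G = {v i, v (Suc i mod n)}"
proof -
  obtain n v where nv: "3 \<le> n" "inj_on v {..<n}" "verts C = v ` {..<n}"
    "(\<lambda>e. e \<inter> verts C) ` edges C = (\<lambda>i. {v i, v (Suc i mod n)}) ` {..<n}"
    and sub: "subgraph C G"
    using assms(2) unfolding cycle_of_def by blast
  have ends: "e \<inter> verts C = e \<inter> verts G" if "e \<in> edges C" for e
    using subgraph_edge_verts[OF sub that] .
  have "\<exists>e\<in>edges C. e \<inter> verts G = {v i, v (Suc i mod n)}" if "i < n" for i
  proof -
    have "{v i, v (Suc i mod n)} \<in> (\<lambda>e. e \<inter> verts C) ` edges C"
      unfolding nv(4) using that by blast
    then obtain e where "e \<in> edges C" "e \<inter> verts C = {v i, v (Suc i mod n)}" by blast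
    then show ?thesis using ends[of e] by metis
  qed
  then obtain E where E: "\<And>i. i < n \<Longrightarrow> E i \<in> edges C"
    "\<And>i. i < n \<Longrightarrow> E i \<inter> verts G = {v i, v (Suc i mod n)}"
    by metis
  have "edges C \<subseteq> E ` {..<n}"
  proof
    fix e assume e: "e \<in> edges C"
    then obtain i where i: "i < n" "e \<inter> verts C = {v i, v (Suc i mod n)}"
      using nv(4) by blast
    then have "e \<inter> verts G = E i \<inter> verts G" using E(2) ends[OF e] by simp
    then have "e = E i"
      using plane_graph_inj_ends[OF assms(1)] e E(1)[OF i(1)] sub
      by (meson subgraph_def subsetD)
    then show "e \<in> E ` {..<n}" using i(1) by blast
  qed
  then have im: "edges C = E ` {..<n}" using E(1) by blast
  have inj: "inj_on E {..<n}"
  proof (rule inj_onI)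
    fix i j assume ij: "i \<in> {..<n}" "j \<in> {..<n}" "E i = E j"
    then have eq: "{v i, v (Suc i mod n)} = {v j, v (Suc j mod n)}"
      using E(2) by (metis lessThan_iff)
    have lt: "Suc i mod n < n" "Suc j mod n < n" using nv(1) by auto
    \<comment> \<open>Otherwise the pairs agree crosswise: \<open>i\<close> and \<open>j\<close> are
      cyclic successors of each other, which is impossible for \<open>n\<close> at least 3.\<close>
    show "i = j"
    proof (rule ccontr)
      assume "i \<noteq> j"
      then have "v i \<noteq> v j" using nv(2) ij by (meson inj_on_contraD)
      then have "v i = v (Suc j mod n)" "v j = v (Suc i mod n)"
        using eq by (auto simp: doubleton_eq_iff)
      then have "i = Suc j mod n" "j = Suc i mod n"
        using nv(2) ij lt by (metis inj_on_eq_iff lessThan_iff)+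
      moreover have "Suc l mod n = (if Suc l = n then 0 else Suc l)" if "l < n" for l
        using that by auto
      ultimately show False using nv(1) ij by (auto split: if_splits)
    qed
  qed
  show thesis using that[OF nv(1-3) im inj] E(2) by blast
qed

lemma cycle_edges_nonempty:
  assumes "cycle_of G C"
  shows "edges C \<noteq> {}"
proof -
  obtain n and v :: "nat \<Rightarrow> complex" where
    "3 \<le> n" and im: "(\<lambda>e. e \<inter> verts C) ` edges C = (\<lambda>i. {v i, v (Suc i mod n)}) ` {..<n}"
    using assms unfolding cycle_of_def by blast
  then have "0 \<in> {..<n}" by simp
  then show ?thesis using im by blast
qed

lemma cycle_verts_nonempty:
  assumes "cycle_of G C"
  shows "verts C \<noteq> {}"
proof -
  obtain n and v :: "nat \<Rightarrow> complex" where "3 \<le> n" and im: "verts C = v ` {..<n}"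
    using assms unfolding cycle_of_def by blast
  then have "0 \<in> {..<n}" by simp
  then show ?thesis using im by blast
qed

lemma cycle_of_subgraph: "cycle_of G C \<Longrightarrow> subgraph C G"
  by (simp add: cycle_of_def)

lemma cycle_of_mono:
  assumes "cycle_of G C" "subgraph C H"
  shows "cycle_of H C"
  using assms by (simp add: cycle_of_def)

lemma cycle_edges_at:
  assumes "plane_graph G" "cycle_of G C" "w \<in> verts C"
  obtains e f where "e \<noteq> f" "{x \<in> edges C. w \<in> x} = {e, f}"
proof -
  obtain n v E where n: "3 \<le> n" "inj_on v {..<n}" "verts C = v ` {..<n}" "edges C = E ` {..<n}"
    "inj_on E {..<n}" and all_ends: "\<forall>i<n. E i \<inter> verts G = {v i, v (Suc i mod n)}"
    by (rule cycle_enum[OF assms(1,2)]) blast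
  have ends: "E i \<inter> verts G = {v i, v (Suc i mod n)}" if "i < n" for i
    using all_ends that by blast
  obtain k where k: "k < n" "w = v k" using assms(3) n(3) by blast
  \<comment> \<open>The cyclic predecessor of \<open>k\<close>; truncated subtraction would wrongly
    give 0 for \<open>k = 0\<close>. The two cycle edges at \<open>v k\<close> are
    \<open>E k\<close> and \<open>E j\<close>.\<close>
  define j where "j = (if k = 0 then n - 1 else k - 1)"
  have j: "j < n" "j \<noteq> k" "Suc j mod n = k" using k n(1) by (auto simp: j_def)
  have wG: "w \<in> verts G"
    using assms(2,3) by (auto simp: cycle_of_def subgraph_def)
  have "w \<in> E i \<longleftrightarrow> i = k \<or> i = j" if i: "i < n" for i
  proof -
    have "w \<in> E i \<longleftrightarrow> v k = v i \<or> v k = v (Suc i mod n)"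
      using ends[OF i] wG k(2) by blast
    also have "\<dots> \<longleftrightarrow> k = i \<or> k = Suc i mod n"
      using n(1,2) i k(1) by (metis (no_types) inj_on_eq_iff lessThan_iff mod_less_divisor
          less_le_trans zero_less_numeral)
    also have "\<dots> \<longleftrightarrow> i = k \<or> i = j"
      using i k(1) n(1) by (auto simp: j_def mod_Suc split: if_splits)
    finally show ?thesis .
  qed
  then have "{x \<in> edges C. w \<in> x} = {E k, E j}" using k(1) j(1) n(4) by auto
  moreover have "E k \<noteq> E j" using n(5) k(1) j by (metis inj_on_eq_iff lessThan_iff)
  ultimately show thesis using that by blast
qed

lemma support_cycle_Int_verts:
  assumes "subgraph C G"
  shows "support C \<inter> verts G = verts C"
  using assms by (auto simp: support_def subgraph_def)

lemma support_cycle: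
  assumes "plane_graph G" "cycle_of G C"
  shows "support C = \<Union>(edges C)"
proof -
  have "w \<in> \<Union>(edges C)" if "w \<in> verts C" for w
    by (rule cycle_edges_at[OF assms that]) blast
  then show ?thesis by (auto simp: support_def)
qed

text \<open>Walk around \<open>D\<close> from \<open>w\<close>: an edge of \<open>D\<close> leaving
  a common vertex belongs to \<open>C\<close>, hence so does its other end, and the walk continues
  until it has passed all of \<open>D\<close>.\<close>

lemma cycle_stays_in_cycle:
  assumes "plane_graph G" "subgraph C G" "cycle_of G D" "w \<in> verts C \<inter> verts D"
    and stay: "\<And>u e. \<lbrakk>u \<in> verts C \<inter> verts D; e \<in> edges D; u \<in> e\<rbrakk> \<Longrightarrow> e \<in> edges C"
  shows "edges D \<subseteq> edges C"
proof -
  obtain n v E where n: "3 \<le> n" "inj_on v {..<n}" "verts D = v ` {..<n}" "edges D = E ` {..<n}"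
    and all_ends: "\<forall>i<n. E i \<inter> verts G = {v i, v (Suc i mod n)}"
    by (rule cycle_enum[OF assms(1,3)]) blast
  have ends: "E i \<inter> verts G = {v i, v (Suc i mod n)}" if "i < n" for i
    using all_ends that by blast
  obtain k where k: "k < n" "w = v k" using assms(4) n(3) by blast
  have in_C: "E i \<in> edges C" if "i < n" "v i \<in> verts C" for i
    using stay[of "v i" "E i"] that n ends[of i] by blast
  have walk: "v ((k + i) mod n) \<in> verts C" for i
  proof (induction i)
    case 0
    then show ?case using k assms(4) by simp
  next
    case (Suc i)
    let ?j = "(k + i) mod n"
    have j: "?j < n" using n(1) by simp
    have "v (Suc ?j mod n) \<in> E ?j \<inter> verts G" using ends[OF j] by simp
    then have "v (Suc ?j mod n) \<in> verts C"
      using in_C[OF j Suc] assms(2) by (auto simp: subgraph_def)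
    then show ?case by (simp add: mod_Suc_eq)
  qed
  have "v i \<in> verts C" if "i < n" for i
  proof -
    \<comment> \<open>Every index \<open>i\<close> is reached from \<open>k\<close> after
      \<open>n - k + i\<close> steps, a count that avoids negative differences.\<close>
    have "(k + (n - k + i)) mod n = i" using k(1) that by simp
    then show ?thesis using walk[of "n - k + i"] by simp
  qed
  then have "E i \<in> edges C" if "i < n" for i using in_C that by simp
  then show ?thesis unfolding n(4) by auto
qed

section \<open>Cycles as Jordan curves\<close>

lemma cycle_support_closed_curve:
  assumes "plane_graph G" "cycle_of G C"
  obtains c where "simple_path c" "pathfinish c = pathstart c" "path_image c = support C"
proof -
  obtain n v E where n: "3 \<le> n" "inj_on v {..<n}" "verts C = v ` {..<n}" "edges C = E ` {..<n}"
    "inj_on E {..<n}" and all_ends: "\<forall>i<n. E i \<inter> verts G = {v i, v (Suc i mod n)}"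
    by (rule cycle_enum[OF assms]) blast
  have ends: "E i \<inter> verts G = {v i, v (Suc i mod n)}" if "i < n" for i
    using all_ends that by blast
  have EG: "E i \<in> edges G" if "i < n" for i
    using that n(4) assms(2) by (auto simp: cycle_of_def subgraph_def)
  have v_eq: "v i = v j \<longleftrightarrow> i = j" if "i < n" "j < n" for i j
    using n(2) that by (auto simp: inj_on_eq_iff)
  have meet: "E i \<inter> E j \<subseteq> {v i, v (Suc i mod n)} \<inter> {v j, v (Suc j mod n)}"
    if "i < n" "j < n" "i \<noteq> j" for i j
  proof -
    have "E i \<noteq> E j" using n(5) that by (auto simp: inj_on_eq_iff)
    then show ?thesis
      using plane_graph_Int_edges[OF assms(1) EG EG] that ends[of i] ends[of j] by blast
  qed
  have arcs: "\<exists>g. arc g \<and> path_image g = E i \<and> pathstart g = v i \<and> pathfinish g = v (Suc i mod n)"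
    if i: "i < n" for i
  proof -
    obtain g where g: "arc g" "path_image g = E i" "E i \<inter> verts G = {pathstart g, pathfinish g}"
      by (rule plane_graph_arcE[OF assms(1) EG[OF i]]) blast
    then consider "pathstart g = v i" "pathfinish g = v (Suc i mod n)"
      | "pathstart g = v (Suc i mod n)" "pathfinish g = v i"
      using ends[OF i] by (auto simp: doubleton_eq_iff)
    then show ?thesis
    proof cases
      case 1
      then show ?thesis using g by blast
    next
      case 2
      then show ?thesis using g
        by (intro exI[of _ "reversepath g"]) (simp add: arc_reversepath)
    qed
  qed
  \<comment> \<open>The edges are concatenated one at a time. The bound \<open>Suc k < n\<close>
    leaves out the closing edge, so the path remains an arc and no index wraps around.\<close>
  have partial: "\<exists>p. arc p \<and> pathstart p = v 0 \<and> pathfinish p = v (Suc k) \<and>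
      path_image p = (\<Union>i\<le>k. E i)" if "Suc k < n" for k
    using that
  proof (induction k)
    case 0
    then show ?case using arcs[of 0] by auto
  next
    case (Suc k)
    then obtain p where p: "arc p" "pathstart p = v 0" "pathfinish p = v (Suc k)"
      "path_image p = (\<Union>i\<le>k. E i)" by auto
    obtain g where g: "arc g" "path_image g = E (Suc k)" "pathstart g = v (Suc k)"
      "pathfinish g = v (Suc (Suc k))"
      using arcs[of "Suc k"] Suc.prems by auto
    \<comment> \<open>The far end of the new edge has not been visited before, so only the junction
      can be shared.\<close>
    have "E i \<inter> E (Suc k) \<subseteq> {v (Suc k)}" if "i \<le> k" for i
    proof -
      have "Suc i mod n = Suc i" "Suc (Suc k) mod n = Suc (Suc k)"
        using that Suc.prems by auto
      moreover have "v i \<noteq> v (Suc (Suc k))" "v (Suc i) \<noteq> v (Suc (Suc k))"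
        using that Suc.prems by (simp_all add: v_eq)
      ultimately show ?thesis using meet[of i "Suc k"] that Suc.prems by fastforce
    qed
    then have "path_image p \<inter> path_image g \<subseteq> {pathstart g}"
      using p(4) g(2,3) by auto
    then have "arc (p +++ g)" using arc_join p(1,3) g(1,3) by metis
    moreover have "path_image (p +++ g) = (\<Union>i\<le>Suc k. E i)"
      using p(3,4) g(2,3) by (simp add: path_image_join atMost_Suc Un_commute)
    ultimately show ?case using p(2) g(4) by (intro exI[of _ "p +++ g"]) simp
  qed
  \<comment> \<open>Edges 0 to \<open>m\<close> form an arc; the last edge \<open>E (Suc m)\<close>
    leads back to \<open>v 0\<close> and meets that arc at most in its two ends, so the join is a
    simple closed curve.\<close>
  define m where "m = n - 2"
  have m: "n = Suc (Suc m)" "0 < m" using n(1) by (auto simp: m_def)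
  obtain p where p: "arc p" "pathstart p = v 0" "pathfinish p = v (Suc m)"
    "path_image p = (\<Union>i\<le>m. E i)" using partial[of m] m by auto
  obtain g where g: "arc g" "path_image g = E (Suc m)" "pathstart g = v (Suc m)"
    "pathfinish g = v 0" using arcs[of "Suc m"] m by auto
  have "E i \<inter> E (Suc m) \<subseteq> {v 0, v (Suc m)}" if "i \<le> m" for i
    using meet[of i "Suc m"] that m by auto
  then have "path_image p \<inter> path_image g \<subseteq> {pathstart p, pathstart g}"
    using p(2,4) g(2,3) by auto
  then have "simple_path (p +++ g)"
    using simple_path_join_loop p(1,2,3) g(1,3,4) by metis
  moreover have "path_image (p +++ g) = support C"
    using p(3,4) g(2,3) m support_cycle[OF assms] n(4)
    by (simp add: path_image_join lessThan_Suc_atMost atMost_Suc Un_commute)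
  ultimately show thesis using that[of "p +++ g"] p(2) g(4) by simp
qed

lemma cycle_Jordan:
  assumes "plane_graph G" "cycle_of G C"
  shows "open (inside (support C))" "connected (inside (support C))"
    "connected (outside (support C))" "\<not> bounded (outside (support C))"
    "closed (support C \<union> inside (support C))"
proof -
  obtain c where c: "simple_path c" "pathfinish c = pathstart c" "path_image c = support C"
    by (rule cycle_support_closed_curve[OF assms]) blast
  show "open (inside (support C))" "connected (inside (support C))"
    "connected (outside (support C))" "\<not> bounded (outside (support C))"
    using Jordan_inside_outside[OF c(1,2)] c(3) by simp_all
  show "closed (support C \<union> inside (support C))"
    using closed_path_image_Un_inside[OF simple_path_imp_path[OF c(1)]] c(3) by simp
qed

text \<open>A connected set that meets \<open>f\<close> and misses \<open>support C\<close> stays in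
  \<open>f\<close>, since leaving it means crossing \<open>frontier f\<close>. The outside is
  unbounded, so it misses \<open>f\<close>; thus \<open>f\<close> meets the inside and absorbs
  it.\<close>

lemma inside_subset_bounded_face:
  assumes "plane_graph G" "cycle_of G C" "f \<noteq> {}" "bounded f" "f \<inter> support C = {}"
    "frontier f \<subseteq> support C"
  shows "inside (support C) \<subseteq> f"
proof -
  note J = cycle_Jordan[OF assms(1,2)]
  have fill: "A \<subseteq> f" if "connected A" "A \<inter> support C = {}" "A \<inter> f \<noteq> {}" for A
    using connected_Int_frontier[of A f] that assms(6) by blast
  have "outside (support C) \<inter> f = {}"
    using fill[OF J(3)] J(4) assms(4) bounded_subset outside_no_overlap by blast
  then have "inside (support C) \<inter> f \<noteq> {}"
    using assms(3,5) inside_Un_outside[of "support C"] by blast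
  then show ?thesis using fill[OF J(2)] inside_no_overlap by blast
qed

section \<open>Perfect matchings and alternating cycles\<close>

lemma perfect_matching_unique:
  assumes "perfect_matching G M" "v \<in> verts G" "e \<in> M" "v \<in> e" "f \<in> M" "v \<in> f"
  shows "e = f"
proof -
  have "\<exists>!e. e \<in> M \<and> v \<in> e" using assms(1,2) by (simp add: perfect_matching_def)
  then show ?thesis using assms(3-6) by blast
qed

lemma perfect_matching_edge:
  assumes "perfect_matching G M" "v \<in> verts G"
  obtains e where "e \<in> M" "e \<in> edges G" "v \<in> e"
proof -
  have "\<exists>!e. e \<in> M \<and> v \<in> e" "M \<subseteq> edges G"
    using assms by (simp_all add: perfect_matching_def)
  then show thesis using that by blast
qed

lemma alternating_edge_at:
  assumes "plane_graph G" "cycle_of G C" "alternating M C" "v \<in> verts C"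
  obtains e f where "{x \<in> edges C. v \<in> x} = {e, f}" "e \<in> M" "f \<notin> M"
proof -
  obtain e f where ef: "e \<noteq> f" "{x \<in> edges C. v \<in> x} = {e, f}"
    by (rule cycle_edges_at[OF assms(1,2,4)]) blast
  then have "e \<in> edges C" "f \<in> edges C" "e \<inter> f \<noteq> {}" by blast+
  then have "e \<in> M \<longleftrightarrow> f \<notin> M" using assms(3) ef(1) unfolding alternating_def by blast
  then show thesis using that[of e f] that[of f e] ef(2) by (auto simp: insert_commute)
qed

text \<open>Alternation puts one of the two cycle edges at \<open>v\<close> into \<open>M\<close>,
  and \<open>M\<close> has no other edge there.\<close>

lemma alternating_matching_edge:
  assumes "plane_graph G" "cycle_of G C" "alternating M C" "perfect_matching G M"
    "v \<in> verts C" "e \<in> M" "v \<in> e"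
  shows "e \<in> edges C"
proof -
  obtain a b where ab: "{x \<in> edges C. v \<in> x} = {a, b}" "a \<in> M"
    by (rule alternating_edge_at[OF assms(1,2,3,5)]) blast
  have "v \<in> verts G" using assms(2,5) by (auto simp: cycle_of_def subgraph_def)
  then have "e = a" using perfect_matching_unique[OF assms(4)] assms(6,7) ab by blast
  then show ?thesis using ab by blast
qed

text \<open>Two edges of \<open>C\<close> that meet share a vertex, where they are the only edges of
  \<open>C\<close>. The matching edge there lies on \<open>C\<close>, so it is one of them, and by
  uniqueness not both.\<close>

lemma alternatingI:
  assumes "plane_graph G" "cycle_of G C" "perfect_matching G M"
    and "\<And>v. v \<in> verts C \<Longrightarrow> \<exists>e\<in>M. e \<in> edges C \<and> v \<in> e"
  shows "alternating M C"
  unfolding alternating_def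
proof (intro ballI impI, elim conjE)
  fix e f assume ef: "e \<in> edges C" "f \<in> edges C" "e \<noteq> f" "e \<inter> f \<noteq> {}"
  have sub: "subgraph C G" using assms(2) by (rule cycle_of_subgraph)
  then have "e \<in> edges G" "f \<in> edges G" using ef by (auto simp: subgraph_def)
  then obtain v where v: "v \<in> e" "v \<in> f" "v \<in> verts G"
    using plane_graph_Int_edges[OF assms(1)] ef by blast
  then have vC: "v \<in> verts C" using sub ef(1) by (auto simp: subgraph_def)
  obtain a b where ab: "a \<noteq> b" "{x \<in> edges C. v \<in> x} = {a, b}"
    by (rule cycle_edges_at[OF assms(1,2) vC]) blast
  have "e \<in> {a, b}" "f \<in> {a, b}" using ab(2) ef v by blast+
  then have "{x \<in> edges C. v \<in> x} = {e, f}" using ab(2) ef(3) by blast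
  moreover obtain d where "d \<in> M" "d \<in> edges C" "v \<in> d" using assms(4)[OF vC] by blast
  ultimately have "d \<in> {e, f}" "d \<in> M" by auto
  then have "e \<in> M \<or> f \<in> M" by auto
  then show "e \<in> M \<longleftrightarrow> f \<notin> M"
    using perfect_matching_unique[OF assms(3) v(3)] v ef(3) by blast
qed

text \<open>The symmetric difference of \<open>M\<close> and \<open>edges C\<close>: at a vertex of
  \<open>C\<close> the matching edge is exchanged for the other cycle edge, and elsewhere nothing
  changes.\<close>

lemma perfect_matching_switch:
  assumes "plane_graph G" "cycle_of G C" "alternating M C" "perfect_matching G M"
  shows "perfect_matching G ((M - edges C) \<union> (edges C - M))" (is "perfect_matching G ?N")
  unfolding perfect_matching_def
proof (intro conjI ballI)
  have sub: "subgraph C G" using assms(2) by (rule cycle_of_subgraph)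
  show "?N \<subseteq> edges G"
    using assms(4) sub by (auto simp: subgraph_def perfect_matching_def)
  fix v assume v: "v \<in> verts G"
  show "\<exists>!e. e \<in> ?N \<and> v \<in> e"
  proof (cases "v \<in> verts C")
    case True
    obtain e f where ef: "{x \<in> edges C. v \<in> x} = {e, f}" "e \<in> M" "f \<notin> M"
      by (rule alternating_edge_at[OF assms(1,2,3) True]) blast
    have M_C: "x \<in> edges C" if "x \<in> M" "v \<in> x" for x
      using alternating_matching_edge[OF assms True] that by blast
    have f: "f \<in> edges C" "v \<in> f" using ef(1) by blast+
    show ?thesis
    proof (rule ex1I[of _ f])
      show "f \<in> ?N \<and> v \<in> f" using f ef(3) by simp
      fix x assume "x \<in> ?N \<and> v \<in> x"
      then have "x \<in> {x \<in> edges C. v \<in> x}" "x \<notin> M" using M_C by auto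
      then show "x = f" unfolding ef(1) using ef(2) by auto
    qed
  next
    case False
    then have "v \<notin> x" if "x \<in> edges C" for x
      using that v sub by (auto simp: subgraph_def)
    moreover have "\<exists>!e. e \<in> M \<and> v \<in> e"
      using assms(4) v by (simp add: perfect_matching_def)
    ultimately show ?thesis by blast
  qed
qed

text \<open>Each edge of \<open>C\<close> lies in \<open>M\<close> or in the matching obtained by
  switching along \<open>C\<close>.\<close>

lemma allowed_edge_alternating_cycle:
  assumes "plane_graph G" "cycle_of G C" "alternating M C" "perfect_matching G M" "e \<in> edges C"
  shows "allowed_edge G e"
  using assms(4,5) perfect_matching_switch[OF assms(1-4)] unfolding allowed_edge_def by blast

section \<open>The graph \<open>I[C]\<close>\<close>

lemma subgraph_inner_graph: "subgraph (inner_graph G C) G"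
  by (auto simp: subgraph_def inner_graph_def)

lemma subgraph_cycle_inner_graph:
  assumes "subgraph C G"
  shows "subgraph C (inner_graph G C)"
  using assms by (auto simp: subgraph_def inner_graph_def support_def)

lemma interior_edge_if_noncycle:
  assumes "plane_graph G" "cycle_of G C" "e \<in> edges (inner_graph G C)" "e \<notin> edges C"
  shows "interior_edge G C e"
proof -
  have e: "e \<in> edges G" "e \<subseteq> support C \<union> inside (support C)"
    using assms(3) by (auto simp: inner_graph_def)
  have "edges C \<subseteq> edges G" using assms(2) by (auto simp: cycle_of_def subgraph_def)
  then have "e \<inter> support C \<subseteq> verts G"
    using plane_graph_Int_edges[OF assms(1) e(1)] assms(4) support_cycle[OF assms(1,2)] by blast
  then show ?thesis using e unfolding interior_edge_def by blast
qed

text \<open>Whatever part of \<open>e\<close> leaves the closed region bounded by \<open>C\<close>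
  consists of vertices, so it is finite and therefore closed. Connectedness of \<open>e\<close>
  forbids such a splitting unless this part is empty.\<close>

lemma interior_edge_in_inner_graph:
  assumes "plane_graph G" "cycle_of G C" "interior_edge G C e"
  shows "e \<in> edges (inner_graph G C)"
proof -
  let ?T = "support C \<union> inside (support C)"
  have e: "e \<in> edges G" "e - verts G \<subseteq> inside (support C)"
    using assms(3) by (auto simp: interior_edge_def)
  have "e - ?T \<subseteq> verts G" using e(2) by blast
  then have fin: "finite (e - ?T)" using finite_verts[OF assms(1)] by (rule finite_subset)
  have "infinite (e - verts G)"
    using infinite_edge[OF assms(1) e(1)] finite_verts[OF assms(1)] by simp
  then have "e - verts G \<noteq> {}" by (metis finite.emptyI)
  then have "?T \<inter> e \<noteq> {}" using e(2) by blast
  moreover have "closed ?T" using cycle_Jordan(5)[OF assms(1,2)] .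
  moreover have "closed (e - ?T)" using fin by (rule finite_imp_closed)
  ultimately have "e - ?T = {}"
    using connected_closedD[OF connected_edge[OF assms(1) e(1)], of ?T "e - ?T"] by blast
  then show ?thesis using e(1) by (auto simp: inner_graph_def)
qed

lemma edge_meeting_inside:
  assumes "plane_graph G" "cycle_of G C" "e \<in> edges G" "e \<inter> inside (support C) \<noteq> {}"
  shows "e \<in> edges (inner_graph G C)"
proof (cases "e \<in> edges C")
  case True
  then show ?thesis
    using subgraph_cycle_inner_graph[OF cycle_of_subgraph[OF assms(2)]] by (auto simp: subgraph_def)
next
  case False
  note J = cycle_Jordan[OF assms(1,2)]
  have "edges C \<subseteq> edges G" using assms(2) by (auto simp: cycle_of_def subgraph_def)
  then have dis: "(e - verts G) \<inter> support C = {}"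
    using plane_graph_Int_edges[OF assms(1,3)] False support_cycle[OF assms(1,2)] by blast
  \<comment> \<open>If only vertices of \<open>e\<close> lay inside, \<open>e\<close> would split
    into a finite, hence closed, piece and its closed remainder. By connectedness \<open>e\<close>
    would consist of vertices only, contrary to its being infinite.\<close>
  have "(e - verts G) \<inter> inside (support C) \<noteq> {}"
  proof
    assume "(e - verts G) \<inter> inside (support C) = {}"
    then have sub: "e \<inter> inside (support C) \<subseteq> verts G" by blast
    then have "closed (e \<inter> inside (support C))"
      using finite_verts[OF assms(1)] by (meson finite_imp_closed finite_subset)
    moreover have "closed (e - inside (support C))"
      using closed_edge[OF assms(1,3)] J(1) by (rule closed_Diff)
    ultimately have "e - inside (support C) = {}"
      using connected_edge[OF assms(1,3)] assms(4) unfolding connected_closed by blast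
    then have "e \<subseteq> verts G" using sub by blast
    then show False
      using infinite_edge[OF assms(1,3)] finite_verts[OF assms(1)] finite_subset by blast
  qed
  \<comment> \<open>An edge without its ends is connected and misses \<open>support C\<close>, so
    having a point inside it cannot leave the inside.\<close>
  moreover have "frontier (inside (support C)) \<subseteq> support C"
    using J(1,5) closure_minimal[of "inside (support C)" "support C \<union> inside (support C)"]
    by (auto simp: frontier_def interior_open)
  ultimately have "e - verts G \<subseteq> inside (support C)"
    using connected_Int_frontier[OF connected_edge_minus_verts[OF assms(1,3)],
        of "inside (support C)"] dis by blast
  then show ?thesis
    using interior_edge_in_inner_graph[OF assms(1,2)] assms(3) by (simp add: interior_edge_def)
qed

section \<open>Perfect matchings of \<open>G\<close> and of \<open>I[C]\<close>\<close>

lemma matching_edge_in_inner_graph: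
  assumes "plane_graph G" "cycle_of G C" "perfect_matching G M" "alternating M C"
    "v \<in> verts (inner_graph G C)" "e \<in> M" "v \<in> e"
  shows "e \<in> edges (inner_graph G C)"
\<comment> \<open>For a vertex strictly inside, topology keeps all its edges in \<open>I[C]\<close>;
  for a vertex on \<open>C\<close>, alternation forces its matching edge onto
  \<open>C\<close>.\<close>
proof (cases "v \<in> inside (support C)")
  case True
  moreover have "e \<in> edges G" using assms(3,6) by (auto simp: perfect_matching_def)
  ultimately show ?thesis using edge_meeting_inside[OF assms(1,2)] assms(7) by blast
next
  case False
  note sub = cycle_of_subgraph[OF assms(2)]
  have "v \<in> verts C"
    using False assms(5) support_cycle_Int_verts[OF sub] by (auto simp: inner_graph_def)
  then have "e \<in> edges C"
    using alternating_matching_edge[OF assms(1,2,4,3)] assms(6,7) by blast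
  then show ?thesis using subgraph_cycle_inner_graph[OF sub] by (auto simp: subgraph_def)
qed

lemma perfect_matching_inner_graph:
  assumes "plane_graph G" "cycle_of G C" "perfect_matching G M" "alternating M C"
  shows "perfect_matching (inner_graph G C) (M \<inter> edges (inner_graph G C))"
proof -
  let ?H = "inner_graph G C"
  have "\<exists>!e. e \<in> M \<inter> edges ?H \<and> v \<in> e" if v: "v \<in> verts ?H" for v
  proof -
    have "v \<in> verts G" using v by (simp add: inner_graph_def)
    then have "\<exists>!e. e \<in> M \<and> v \<in> e" using assms(3) by (simp add: perfect_matching_def)
    then show ?thesis using matching_edge_in_inner_graph[OF assms v] by blast
  qed
  then show ?thesis by (simp add: perfect_matching_def)
qed

text \<open>A perfect matching of \<open>I[C]\<close> is completed by the edges outside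
  \<open>I[C]\<close> of a matching for which \<open>C\<close> is alternating. The pieces do not
  collide, as no such outside edge touches a vertex of \<open>I[C]\<close>.\<close>

lemma allowed_edge_inner_graph:
  assumes "plane_graph G" "nice_cycle G C" "allowed_edge (inner_graph G C) e"
  shows "allowed_edge G e"
proof -
  let ?H = "inner_graph G C"
  obtain M where C: "cycle_of G C" and M: "perfect_matching G M" "alternating M C"
    using assms(2) unfolding nice_cycle_def by blast
  obtain N where N: "perfect_matching ?H N" "e \<in> N"
    using assms(3) unfolding allowed_edge_def by blast
  let ?L = "N \<union> (M - edges ?H)"
  have NH: "N \<subseteq> edges ?H" using N(1) by (simp add: perfect_matching_def)
  have "perfect_matching G ?L"
    unfolding perfect_matching_def
  proof (intro conjI ballI)
    show "?L \<subseteq> edges G"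
      using NH M(1) subgraph_inner_graph[of G C] by (auto simp: perfect_matching_def subgraph_def)
    fix v assume v: "v \<in> verts G"
    show "\<exists>!e. e \<in> ?L \<and> v \<in> e"
    proof (cases "v \<in> verts ?H")
      case True
      then have "\<exists>!e. e \<in> N \<and> v \<in> e" using N(1) by (simp add: perfect_matching_def)
      then show ?thesis using matching_edge_in_inner_graph[OF assms(1) C M True] by blast
    next
      case False
      then have "v \<notin> e" if "e \<in> edges ?H" for e
        using that v by (auto simp: inner_graph_def)
      moreover have "\<exists>!e. e \<in> M \<and> v \<in> e" using M(1) v by (simp add: perfect_matching_def)
      ultimately show ?thesis using NH by blast
    qed
  qed
  then show ?thesis using N(2) unfolding allowed_edge_def by blast
qed

section \<open>Resonant sets\<close>

lemma subgraph_delete_faces: "subgraph (delete_faces G K) G"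
  by (auto simp: subgraph_def delete_faces_def Let_def)

text \<open>Boundaries of faces in \<open>K\<close> share no vertex, so choosing a vertex on each is
  injective. The bound makes a maximum resonant set exist.\<close>

lemma card_resonant_set_le:
  assumes "plane_graph G" "resonant_set G K"
  shows "card K \<le> card (verts G)"
proof -
  have "\<exists>v. v \<in> frontier f \<inter> verts G" if f: "f \<in> K" for f
  proof -
    obtain D where D: "cycle_of G D" "frontier f = support D"
      using assms(2) f unfolding resonant_set_def resonant_face_def by blast
    then have "frontier f \<inter> verts G = verts D"
      using support_cycle_Int_verts[OF cycle_of_subgraph] by simp
    then show ?thesis using cycle_verts_nonempty[OF D(1)] by blast
  qed
  then obtain v where v: "\<And>f. f \<in> K \<Longrightarrow> v f \<in> frontier f \<inter> verts G" by metis
  have "pairwise (\<lambda>f g. frontier f \<inter> frontier g \<inter> verts G = {}) K"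
    using assms(2) by (simp add: resonant_set_def)
  then have "inj_on v K"
    using v unfolding pairwise_def inj_on_def by (metis IntD1 IntD2 IntI empty_iff)
  moreover have "v ` K \<subseteq> verts G" using v by blast
  ultimately show ?thesis using finite_verts[OF assms(1)] by (rule card_inj_on_le)
qed

lemma maximum_resonant_set_exists:
  assumes "plane_graph G" "perfect_matching G M"
  obtains K where "maximum_resonant_set G K"
proof -
  have "resonant_set G {}" using assms(2) by (auto simp: resonant_set_def)
  moreover have "\<forall>K. resonant_set G K \<longrightarrow> card K < Suc (card (verts G))"
    using card_resonant_set_le[OF assms(1)] by (simp add: less_Suc_eq_le)
  ultimately obtain K where "resonant_set G K" "\<forall>K'. resonant_set G K' \<longrightarrow> card K' \<le> card K"
    using ex_has_greatest_nat[of "resonant_set G" "{}" card] by blast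
  then show thesis using that by (simp add: maximum_resonant_set_def)
qed

text \<open>A matching edge at a deleted vertex lies on the alternating boundary of some face in
  \<open>K\<close>, so its other end is deleted too. The matching edges at surviving vertices
  therefore survive.\<close>

lemma perfect_matching_delete_faces:
  assumes "plane_graph G" "perfect_matching G M" "\<And>f. f \<in> K \<Longrightarrow> resonant_face G M f"
  shows "perfect_matching (delete_faces G K) (M \<inter> edges (delete_faces G K))"
proof -
  let ?S = "verts G \<inter> (\<Union>f\<in>K. frontier f)"
  have del: "verts (delete_faces G K) = verts G - ?S"
    "edges (delete_faces G K) = {e \<in> edges G. e \<inter> ?S = {}}"
    by (simp_all add: delete_faces_def Let_def)
  have avoid: "e \<inter> ?S = {}" if e: "e \<in> M" "v \<in> e" "v \<in> verts G - ?S" for e v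
  proof (rule ccontr)
    assume "e \<inter> ?S \<noteq> {}"
    then obtain w f where w: "w \<in> e" "w \<in> verts G" "f \<in> K" "w \<in> frontier f" by blast
    obtain D where D: "cycle_of G D" "frontier f = support D" "alternating M D"
      using assms(3)[OF w(3)] unfolding resonant_face_def by blast
    note sub = cycle_of_subgraph[OF D(1)]
    have "w \<in> verts D" using support_cycle_Int_verts[OF sub] D(2) w by blast
    then have "e \<in> edges D"
      using alternating_matching_edge[OF assms(1) D(1,3) assms(2)] e(1) w(1) by blast
    then have "v \<in> frontier f" using D(2) e(2) by (auto simp: support_def)
    then show False using e(3) w(3) by blast
  qed
  show ?thesis
    unfolding perfect_matching_def
  proof (intro conjI ballI)
    fix v assume "v \<in> verts (delete_faces G K)"
    then have v: "v \<in> verts G - ?S" using del(1) by simp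
    then have "\<exists>!e. e \<in> M \<and> v \<in> e" using assms(2) by (simp add: perfect_matching_def)
    moreover have "e \<in> edges (delete_faces G K)" if "e \<in> M" "v \<in> e" for e
      using avoid[OF that v] that assms(2) del(2) by (auto simp: perfect_matching_def)
    ultimately show "\<exists>!e. e \<in> M \<inter> edges (delete_faces G K) \<and> v \<in> e" by blast
  qed simp
qed

section \<open>Contradiction from two perfect matchings of \<open>I[C] - K\<close>\<close>

theorem theorem4p4:
  fixes G :: geom_graph
  assumes "plane_graph G"
    and "connected_graph G"
    and "bipartite G"
    and "\<exists>M. perfect_matching G M"
    and "\<And>C K. nice_cycle G C \<Longrightarrow> maximum_resonant_set (inner_graph G C) K \<Longrightarrow>
           \<exists>!M. perfect_matching (delete_faces (inner_graph G C) K) M"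
  shows "weakly_elementary G"
  unfolding weakly_elementary_def
proof (intro allI impI, elim conjE exE, rule ccontr)
  fix C e\<^sub>0
  assume nice: "nice_cycle G C" and e\<^sub>0: "interior_edge G C e\<^sub>0"
    and "\<nexists>e. interior_edge G C e \<and> allowed_edge G e \<and> e \<inter> verts C \<noteq> {}"
  then have none: "\<not> allowed_edge G e" if "interior_edge G C e" "v \<in> e" "v \<in> verts C" for e v
    using that by blast
  define H where "H = inner_graph G C"
  obtain M\<^sub>0 where C: "cycle_of G C" and M\<^sub>0: "perfect_matching G M\<^sub>0" "alternating M\<^sub>0 C"
    using nice unfolding nice_cycle_def by blast
  have HG: "subgraph H G" unfolding H_def by (rule subgraph_inner_graph)
  have pH: "plane_graph H" using plane_graph_subgraph[OF assms(1) HG] .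
  have CH: "subgraph C H"
    unfolding H_def using subgraph_cycle_inner_graph[OF cycle_of_subgraph[OF C]] .
  have cycH: "cycle_of H C" using cycle_of_mono[OF C CH] .
  \<comment> \<open>Off \<open>C\<close>, such an edge would be an interior edge that is allowed in
    \<open>G\<close> and meets \<open>C\<close>, which \<open>none\<close> excludes.\<close>
  have at_C: "e \<in> edges C" if "allowed_edge H e" "v \<in> e" "v \<in> verts C" for e v
  proof (rule ccontr)
    assume "e \<notin> edges C"
    moreover have "e \<in> edges H"
      using that(1) by (auto simp: allowed_edge_def perfect_matching_def)
    ultimately have "interior_edge G C e"
      using interior_edge_if_noncycle[OF assms(1) C] by (simp add: H_def)
    moreover have "allowed_edge G e"
      using allowed_edge_inner_graph[OF assms(1) nice] that(1) by (simp add: H_def)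
    ultimately show False using none that(2,3) by blast
  qed
  obtain K where K: "maximum_resonant_set H K"
    using maximum_resonant_set_exists[OF pH]
      perfect_matching_inner_graph[OF assms(1) C M\<^sub>0] by (metis H_def)
  then obtain M where M: "perfect_matching H M" and res: "\<And>f. f \<in> K \<Longrightarrow> resonant_face H M f"
    unfolding maximum_resonant_set_def resonant_set_def by blast
  have avoid: "frontier f \<inter> verts C = {}" if f: "f \<in> K" for f
  proof (rule ccontr)
    assume "frontier f \<inter> verts C \<noteq> {}"
    then obtain w where w: "w \<in> frontier f" "w \<in> verts C" by blast
    obtain D where D: "cycle_of H D" "frontier f = support D" "alternating M D"
      and face: "f \<in> components (- support H)" "bounded f"
      using res[OF f] unfolding resonant_face_def finite_faces_def by blast
    have "w \<in> verts H" using CH w(2) by (auto simp: subgraph_def)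
    then have "w \<in> verts C \<inter> verts D"
      using w D(2) support_cycle_Int_verts[OF cycle_of_subgraph[OF D(1)]] by blast
    moreover have "e \<in> edges C" if "u \<in> verts C \<inter> verts D" "e \<in> edges D" "u \<in> e" for u e
      using at_C[OF allowed_edge_alternating_cycle[OF pH D(1,3) M that(2)] that(3)] that(1) by blast
    ultimately have "edges D \<subseteq> edges C" using cycle_stays_in_cycle[OF pH CH D(1)] by blast
    then have "frontier f \<subseteq> support C"
      using D(2) support_cycle[OF pH D(1)] support_cycle[OF pH cycH] by blast
    moreover have "f \<noteq> {}" "f \<subseteq> - support H"
      using face(1) in_components_nonempty in_components_subset by blast+
    moreover have "support C \<subseteq> support H" using CH by (auto simp: subgraph_def support_def)
    ultimately have "inside (support C) \<subseteq> f"
      using inside_subset_bounded_face[OF pH cycH _ face(2)] by blast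
    \<comment> \<open>Now \<open>f\<close> contains the inside of \<open>C\<close>, hence
      \<open>e\<^sub>0\<close> without its ends, but as a face of \<open>H\<close> it misses
      \<open>support H\<close>. So \<open>e\<^sub>0\<close> would consist of vertices only.\<close>
    moreover have "e\<^sub>0 \<subseteq> support H"
      using interior_edge_in_inner_graph[OF assms(1) C e\<^sub>0] by (auto simp: H_def support_def)
    moreover have "e\<^sub>0 - verts G \<subseteq> inside (support C)" "e\<^sub>0 \<in> edges G"
      using e\<^sub>0 by (auto simp: interior_edge_def)
    ultimately have "e\<^sub>0 \<subseteq> verts G" using \<open>f \<subseteq> - support H\<close> by blast
    then show False
      using infinite_edge[OF assms(1) \<open>e\<^sub>0 \<in> edges G\<close>] finite_verts[OF assms(1)] finite_subset
      by blast
  qed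
  define L where "L = delete_faces H K"
  have LH: "subgraph L H" unfolding L_def by (rule subgraph_delete_faces)
  have pL: "plane_graph L" using plane_graph_subgraph[OF pH LH] .
  have "e \<inter> verts H \<subseteq> verts C" if "e \<in> edges C" for e
    using that CH by (auto simp: subgraph_def)
  then have "subgraph C L"
    using CH avoid by (fastforce simp: subgraph_def L_def delete_faces_def Let_def)
  then have cycL: "cycle_of L C" using cycle_of_mono[OF C] by blast
  have matL: "perfect_matching L (M \<inter> edges L)"
    unfolding L_def using perfect_matching_delete_faces[OF pH M res] .
  \<comment> \<open>Edges of \<open>M\<close> are allowed in \<open>H\<close>, so by
    \<open>at_C\<close> those meeting \<open>C\<close> lie on \<open>C\<close>; this is the
    criterion of \<open>alternatingI\<close>.\<close>
  have "alternating (M \<inter> edges L) C"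
  proof (rule alternatingI[OF pL cycL matL])
    fix v assume v: "v \<in> verts C"
    then have "v \<in> verts L" using \<open>subgraph C L\<close> by (auto simp: subgraph_def)
    then obtain e where e: "e \<in> M \<inter> edges L" "v \<in> e"
      using perfect_matching_edge[OF matL] by blast
    then have "allowed_edge H e" using M by (auto simp: allowed_edge_def)
    then show "\<exists>e\<in>M \<inter> edges L. e \<in> edges C \<and> v \<in> e" using at_C e v by blast
  qed
  then have "perfect_matching L ((M \<inter> edges L - edges C) \<union> (edges C - M \<inter> edges L))"
    using perfect_matching_switch[OF pL cycL _ matL] by blast
  \<comment> \<open>Uniqueness identifies the matching with its switched version, although the two
    disagree on every edge of \<open>C\<close>.\<close>
  then have "M \<inter> edges L = (M \<inter> edges L - edges C) \<union> (edges C - M \<inter> edges L)"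
    using assms(5)[OF nice, of K] K matL unfolding H_def L_def by blast
  then show False using cycle_edges_nonempty[OF C] by blast
qed

end
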